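(* For any positive integer $m$ and real $a>0$, \begin{align*} &\frac{2^{m-2}(1-i^{a+1})}{(1+i)^{a-1}}\int_0^\infty \frac{x^a\, dx}{(\cos x+\cosh x)^m}\\ &=\sum_{l=0}^{\lfloor (m-1)/2\rfloor}\sum_{j=0}^{m-1-2l}\frac{(-1)^{l+1}2^l\gamma_{l,m}}{(m-1-2l-j)!}\binom{a}{j}\pi^{a+1-j}\lim_{y\to\pi}\frac{d^{m-1-2l-j}}{dy^{m-1-2l-j}}\left\{\sum_{n=1}^\infty(-1)^{mn}\frac{\tilde n^{\,a+1+2l-m}}{\cosh^m(\tilde n y)}\right\}, \end{align*} where $\tilde n=\frac{2n-1}{2}$.
   Context: $\gamma_{l,m}:=(-1)^m2^l\sum_{k_1+\cdots+k_m=l,\ k_j\ge0}\prod_{j=1}^m\frac{(1-2^{1-2k_j})B_{2k_j}}{(2k_j)!}$, where $B_n$ are the Bernoulli numbers ($\frac{x}{e^x-1}=\sum_{n\ge0}\frac{B_n}{n!}x^n$). For real $a$, $\binom{a}{j}=\frac{a(a-1)\cdots(a-j+1)}{j!}$, and the complex powers $i^{a+1}$, $(1+i)^{a-1}$ are taken with the principal branch. *)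

theory Defs
  imports "HOL-Analysis.Analysis"
begin

definition bernoulli :: "nat \<Rightarrow> real" where
  "bernoulli n = fact n * fps_nth (fps_X / (fps_exp 1 - 1)) n"

text \<open>Division of formal power series rounds when it is not exact; here it is exact.\<close>
lemma bernoulli_generating_function:
  "Abs_fps (\<lambda>n. bernoulli n / fact n) * (fps_exp 1 - 1) = (fps_X :: real fps)"
proof -
  have "subdegree (fps_exp 1 - 1 :: real fps) = 1"
    by (rule subdegreeI) auto
  moreover from this have "fps_exp 1 - 1 \<noteq> (0 :: real fps)"
    by auto
  ultimately have "(fps_exp 1 - 1 :: real fps) dvd fps_X"
    by (simp add: fps_dvd_iff)
  moreover have "Abs_fps (\<lambda>n. bernoulli n / fact n) = (fps_X / (fps_exp 1 - 1) :: real fps)"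
    by (rule fps_ext) (simp add: bernoulli_def)
  ultimately show ?thesis
    by (simp only: dvd_div_mult_self)
qed

text \<open>The tuples \<open>(k\<^sub>1, \<dots>, k\<^sub>m)\<close> are functions on \<open>{1..m}\<close>, extended by \<open>undefined\<close>
  outside so that each tuple is counted exactly once.\<close>
definition tuples_with_sum :: "nat \<Rightarrow> nat \<Rightarrow> (nat \<Rightarrow> nat) set" where
  "tuples_with_sum l m = {k \<in> {1..m} \<rightarrow>\<^sub>E UNIV. (\<Sum>j=1..m. k j) = l}"

lemma finite_tuples_with_sum: "finite (tuples_with_sum l m)"
proof (rule finite_subset)
  have "k j \<le> l" if "(\<Sum>j=1..m. k j) = l" "j \<in> {1..m}" for k :: "nat \<Rightarrow> nat" and j
    using member_le_sum[of j "{1..m}" k] that by simp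
  then show "tuples_with_sum l m \<subseteq> {1..m} \<rightarrow>\<^sub>E {..l}"
    by (auto simp: tuples_with_sum_def PiE_def)
  show "finite ({1..m} \<rightarrow>\<^sub>E {..l})"
    by (intro finite_PiE) auto
qed

definition gamma_coeff :: "nat \<Rightarrow> nat \<Rightarrow> real" where
  "gamma_coeff l m = (-1) ^ m * 2 ^ l *
     (\<Sum>k\<in>tuples_with_sum l m.
        \<Prod>j=1..m. (1 - 2 powi (1 - 2 * int (k j))) * bernoulli (2 * k j) / fact (2 * k j))"

definition half_odd :: "nat \<Rightarrow> real" where
  "half_odd n = (2 * real n - 1) / 2"

text \<open>The series over \<open>n \<ge> 1\<close>; \<open>suminf\<close> starts at 0, hence the shift by \<open>Suc\<close>.\<close>
definition cosh_series :: "real \<Rightarrow> nat \<Rightarrow> nat \<Rightarrow> real \<Rightarrow> real" where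
  "cosh_series a l m y =
     (\<Sum>n. (-1) ^ (m * Suc n) * half_odd (Suc n) powr (a + 1 + 2 * real l - real m)
            / cosh (half_odd (Suc n) * y) ^ m)"

end

theory Submission
  imports Defs "HOL-Complex_Analysis.Complex_Analysis" "HOL-Real_Asymp.Real_Asymp"
begin

unbundle no vec_syntax

text \<open>
  Integrate \<open>z\<^sup>a / (cos z + cosh z)\<^sup>m\<close> along the square with opposite corners \<open>0\<close> and
  \<open>N \<pi> (1 + \<i>)\<close>. Since \<open>cos (\<i> y) = cosh y\<close>, the sides on the axes contribute
  \<open>1 - \<i>\<^bsup>a+1\<^esup>\<close> times the integral in question, while the other two sides vanish in the limit.
  From \<open>cos z + cosh z = 2 cos ((1 + \<i>) z / 2) cos ((1 - \<i>) z / 2)\<close>, the poles are the points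
  \<open>(1 + \<i>) x\<close> with \<open>x = (n - 1/2) \<pi>\<close>, and at \<open>(1 + \<i>) (x + u)\<close> the denominator is
  \<open>(2 (-1)\<^sup>n sin u cosh (x + u))\<^sup>m\<close>. Each residue is thus the coefficient of \<open>u\<^bsup>m-1\<^esup>\<close> in
  \<open>(x + u)\<^sup>a (u / sin u)\<^sup>m / cosh\<^sup>m (x + u)\<close>: the three factors produce the binomial coefficients,
  the \<open>\<gamma>\<^bsub>l,m\<^esub>\<close>, and the derivatives of the hyperbolic series.
\<close>

section \<open>The power series of \<open>(u / sin u)\<^sup>m\<close>\<close>

text \<open>The multinomial coefficient formula over the lists \<open>natpermute l m\<close> is
  carried over to the extensional functions used in \<open>gamma_coeff\<close>; position
  \<open>j - 1\<close> of a list is index \<open>j\<close> of a tuple.\<close>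

lemma fps_power_nth_tuples:
  fixes A :: "'a::comm_ring_1 fps"
  assumes "m > 0"
  shows "(A ^ m) $ l = (\<Sum>k\<in>tuples_with_sum l m. \<Prod>j=1..m. A $ k j)"
proof -
  let ?f = "\<lambda>v. restrict (\<lambda>j. v ! (j - 1)) {1..m}"
  let ?g = "\<lambda>k. map k [1..<Suc m]"
  have prod_shift: "(\<Prod>j=1..m. h (j - 1)) = (\<Prod>j=0..m-1. h j)" for h :: "nat \<Rightarrow> 'a"
    using assms by (intro prod.reindex_bij_witness[of _ Suc "\<lambda>j. j - 1"]) auto
  have sum_shift: "(\<Sum>j=1..m. h (j - 1)) = (\<Sum>j<m. h j)" for h :: "nat \<Rightarrow> nat"
    by (intro sum.reindex_bij_witness[of _ Suc "\<lambda>j. j - 1"]) auto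
  have "(A ^ m) $ l = (\<Sum>v\<in>natpermute l m. \<Prod>j=0..m-1. A $ (v ! j))"
    using assms by (simp add: fps_power_nth)
  also have "\<dots> = (\<Sum>k\<in>tuples_with_sum l m. \<Prod>j=1..m. A $ k j)"
  proof (intro sum.reindex_bij_witness[of _ ?g ?f])
    fix v assume v: "v \<in> natpermute l m"
    hence len: "length v = m" and sl: "sum_list v = l"
      by (auto simp: natpermute_def)
    show "?g (?f v) = v"
      using len by (intro nth_equalityI) (auto simp del: upt_Suc)
    have "(\<Sum>j=1..m. ?f v j) = (\<Sum>j=1..m. v ! (j - 1))"
      by (intro sum.cong) auto
    also have "\<dots> = l"
      using sl len sum_shift[of "\<lambda>j. v ! j"] by (simp add: sum_list_sum_nth atLeast0LessThan)
    finally show "?f v \<in> tuples_with_sum l m"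
      by (auto simp: tuples_with_sum_def)
    have "(\<Prod>j=1..m. A $ (?f v j)) = (\<Prod>j=1..m. A $ (v ! (j - 1)))"
      by (intro prod.cong) auto
    thus "(\<Prod>j=1..m. A $ (?f v j)) = (\<Prod>j=0..m-1. A $ (v ! j))"
      by (simp only: prod_shift[of "\<lambda>j. A $ (v ! j)"])
  next
    fix k assume k: "k \<in> tuples_with_sum l m"
    hence k_ext: "k \<in> extensional {1..m}" and s: "(\<Sum>j=1..m. k j) = l"
      by (auto simp: tuples_with_sum_def PiE_def)
    show "?f (?g k) = k"
      using k_ext by (intro ext) (auto simp: extensional_def simp del: upt_Suc)
    have "sum_list (?g k) = (\<Sum>j=1..m. k j)"
      by (simp only: sum_list_distinct_conv_sum_set distinct_upt set_upt atLeastLessThanSuc_atLeastAtMost)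
    thus "?g k \<in> natpermute l m"
      using s by (simp add: natpermute_def)
  qed
  finally show ?thesis .
qed

text \<open>The quotient is exact because \<open>fps_sin 1\<close> has subdegree 1.\<close>

definition inv_sinc_fps :: "complex fps" where
  "inv_sinc_fps = fps_X / fps_sin 1"

text \<open>Up to the factor \<open>- ((-4) ^ k)\<close>, this is the coefficient of
  \<open>u ^ (2 * k)\<close> in \<open>u / sin u\<close>.\<close>

definition gamma_factor :: "nat \<Rightarrow> real" where
  "gamma_factor k = (1 - 2 powi (1 - 2 * int k)) * bernoulli (2 * k) / fact (2 * k)"

lemma gamma_coeff_conv_fps:
  assumes "m > 0"
  shows "gamma_coeff l m = (-1) ^ m * 2 ^ l * (Abs_fps gamma_factor ^ m) $ l"
  by (simp add: gamma_coeff_def fps_power_nth_tuples[OF assms] gamma_factor_def)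

lemma inv_sinc_fps_mult_sin: "inv_sinc_fps * fps_sin 1 = fps_X"
proof -
  have sd: "subdegree (fps_sin 1 :: complex fps) = 1"
    by (rule subdegreeI) auto
  hence "fps_sin 1 \<noteq> (0 :: complex fps)" by auto
  hence "(fps_sin 1 :: complex fps) dvd fps_X"
    using sd by (simp add: fps_dvd_iff)
  thus ?thesis by (simp add: inv_sinc_fps_def)
qed

text \<open>With \<open>b = x / (e^x - 1)\<close> one has \<open>x / sinh x = 2 b(x) - b(2x)\<close>; this series is even, so its odd
  coefficients vanish, and replacing \<open>x\<close> by \<open>\<i> x\<close> gives \<open>x / sin x\<close>.\<close>
lemma inv_sinc_fps_nth:
  "inv_sinc_fps $ n =
     (if even n then of_real (- ((-4) ^ (n div 2)) * gamma_factor (n div 2)) else 0)"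
proof -
  define b :: "complex fps" where "b = Abs_fps (\<lambda>n. of_real (bernoulli n / fact n))"
  let ?X = "fps_X :: complex fps" and ?E = "fps_exp :: complex \<Rightarrow> complex fps"
  have b: "b * (?E 1 - 1) = ?X"
  proof (rule fps_ext)
    fix n
    have "of_real ((Abs_fps (\<lambda>n. bernoulli n / fact n) * (fps_exp 1 - 1) :: real fps) $ n)
            = (of_real ((fps_X :: real fps) $ n) :: complex)"
      by (simp only: bernoulli_generating_function)
    thus "(b * (?E 1 - 1)) $ n = ?X $ n"
      by (simp add: fps_mult_nth b_def if_distrib[of of_real] cong: if_cong)
  qed
  define b2 where "b2 = b oo (fps_const 2 * ?X)"
  have b2: "b2 * (?E 2 - 1) = 2 * ?X"
  proof -
    have "(b * (?E 1 - 1)) oo (fps_const 2 * ?X) = fps_const 2 * ?X"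
      by (simp add: b)
    hence "b2 * (?E 2 - 1) = fps_const 2 * ?X"
      by (simp add: fps_compose_mult_distrib fps_compose_sub_distrib b2_def)
    thus ?thesis by (simp add: numeral_fps_const)
  qed
  define P where "P = 2 * b - b2"
  have E2: "?E 2 = ?E 1 * ?E 1" and E0: "?E 1 * ?E (-1) = 1"
    by (simp_all flip: fps_exp_add_mult)
  have P: "P * (?E 1 - ?E (-1)) = 2 * ?X"
  proof -
    \<comment> \<open>Multiplying by e^x turns e^x - e^(-x) into e^(2x) - 1 = (e^x - 1) (e^x + 1),
      so the equations for \<open>b\<close> and \<open>b2\<close> both apply; e^x is cancelled at
      the end.\<close>
    have "P * (?E 1 - ?E (-1)) * ?E 1 = P * (?E 2 - ?E 1 * ?E (-1))"
      by (simp add: E2 algebra_simps)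
    also have "\<dots> = 2 * b * (?E 2 - 1) - b2 * (?E 2 - 1)"
      by (simp add: E0 P_def algebra_simps)
    also have "b * (?E 2 - 1) = b * (?E 1 - 1) * (?E 1 + 1)"
      by (simp add: E2 algebra_simps)
    hence "2 * b * (?E 2 - 1) = 2 * (?X * (?E 1 + 1))"
      by (simp add: b mult.assoc)
    also have "2 * (?X * (?E 1 + 1)) - b2 * (?E 2 - 1) = 2 * ?X * ?E 1"
      unfolding b2 by (simp add: algebra_simps)
    finally show ?thesis by simp
  qed
  have P_nth: "P $ n = of_real ((2 - 2 ^ n) * (bernoulli n / fact n))" for n
  proof -
    have "b2 $ n = 2 ^ n * b $ n"
      by (simp only: b2_def fps_compose_linear fps_nth_Abs_fps)
    thus ?thesis by (simp add: P_def b_def numeral_fps_const algebra_simps)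
  qed
  have odd0: "P $ n = 0" if "odd n" for n
  proof -
    \<comment> \<open>Both e^x - e^(-x) and 2x are odd, so P(-x) solves the same equation as P(x),
      and the nonzero factor cancels.\<close>
    have "(P * (?E 1 - ?E (-1))) oo (fps_const (-1) * ?X) = (2 * ?X) oo (fps_const (-1) * ?X)"
      by (simp only: P)
    hence "(P oo (fps_const (-1) * ?X)) * (?E (-1) - ?E 1) = - (2 * ?X)"
      by (simp add: fps_compose_mult_distrib fps_compose_sub_distrib numeral_fps_const del: fps_const_neg)
    hence *: "(P oo (fps_const (-1) * ?X)) * (?E 1 - ?E (-1)) = P * (?E 1 - ?E (-1))"
      unfolding P by (simp add: algebra_simps)
    have "(?E 1 - ?E (-1)) $ 1 \<noteq> 0" by simp
    hence "?E 1 - ?E (-1) \<noteq> 0" by (metis fps_zero_nth)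
    with * have "P oo (fps_const (-1) * ?X) = P" by simp
    hence "(-1) ^ n * P $ n = P $ n" by (metis fps_compose_linear fps_nth_Abs_fps)
    thus ?thesis using that by simp
  qed
  have "(P * (?E 1 - ?E (-1))) oo (fps_const \<i> * ?X) = (2 * ?X) oo (fps_const \<i> * ?X)"
    by (simp only: P)
  hence "(P oo (fps_const \<i> * ?X)) * (?E \<i> - ?E (-\<i>)) = fps_const (2 * \<i>) * ?X"
    by (simp add: fps_compose_mult_distrib fps_compose_sub_distrib numeral_fps_const)
  moreover have "?E \<i> - ?E (-\<i>) = fps_const (2 * \<i>) * fps_sin 1"
  proof -
    have "fps_sin 1 = (?E \<i> - ?E (-\<i>)) * fps_const (inverse (2 * \<i>))"
      using fps_sin_fps_exp_ii[of 1] by (simp add: fps_divide_unit fps_const_inverse)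
    hence "fps_const (2 * \<i>) * fps_sin 1 =
        (?E \<i> - ?E (-\<i>)) * (fps_const (2 * \<i>) * fps_const (inverse (2 * \<i>)))"
      by (simp only: mult_ac)
    thus ?thesis by simp
  qed
  ultimately have "fps_const (2 * \<i>) * ((P oo (fps_const \<i> * ?X)) * fps_sin 1) =
      fps_const (2 * \<i>) * (inv_sinc_fps * fps_sin 1)"
    by (simp only: inv_sinc_fps_mult_sin) (simp add: algebra_simps)
  moreover have "(fps_sin 1 :: complex fps) $ 1 \<noteq> 0" by simp
  hence "(fps_sin 1 :: complex fps) \<noteq> 0" by (metis fps_zero_nth)
  ultimately have eq: "inv_sinc_fps = P oo (fps_const \<i> * ?X)"
    by simp
  show ?thesis
  proof (cases "even n")
    case True
    then obtain k where n: "n = 2 * k" by blast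
    \<comment> \<open>For n = 2k this rewrites 2 - 2^n as -4^k (1 - 2^(1-2k)), the shape in which
      the factor occurs in \<open>gamma_factor\<close>.\<close>
    have "4 ^ k * (2::real) powi (1 - 2 * int k) = 2"
      by (simp add: power_int_diff power_int_mult)
    moreover have "(2::real) ^ n = 4 ^ k"
      by (simp add: n power_mult)
    ultimately have "(2::real) - 2 ^ n = - (4 ^ k * (1 - 2 powi (1 - 2 * int k)))"
      by (simp add: right_diff_distrib)
    moreover have "inv_sinc_fps $ n = of_real ((-1) ^ k * ((2 - 2 ^ n) * (bernoulli n / fact n)))"
      by (simp add: eq fps_compose_linear P_nth n power_mult)
    ultimately show ?thesis
      by (simp add: n gamma_factor_def power_minus[of 4])
  next
    case False
    thus ?thesis by (simp add: eq fps_compose_linear odd0)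
  qed
qed

text \<open>Since u / sin u = -S(u^2) with S(t) = C(-4t), and substitution commutes with powers, the
  coefficients come from those of C^m. The sign (-1)^m and one factor 2^l of 4^l = 2^l 2^l are
  absorbed into \<open>gamma_coeff l m\<close>.\<close>

lemma inv_sinc_fps_power_nth:
  assumes "m > 0"
  shows "(inv_sinc_fps ^ m) $ n =
    (if even n then of_real ((-1) ^ (n div 2) * 2 ^ (n div 2) * gamma_coeff (n div 2) m) else 0)"
proof -
  define C where "C = Abs_fps (\<lambda>k. complex_of_real (gamma_factor k))"
  have C_pow: "(C ^ m) $ l = of_real ((Abs_fps gamma_factor ^ m) $ l)" for l
    by (simp add: fps_power_nth_tuples[OF assms] C_def)
  define S where "S = C oo (fps_const (-4) * fps_X)"
  have "inv_sinc_fps = fps_const (-1) * (S oo (fps_X ^ 2))"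
    by (rule fps_ext)
       (auto simp: fps_mult_left_const_nth inv_sinc_fps_nth S_def fps_nth_compose_X_power fps_compose_linear C_def)
  hence "inv_sinc_fps ^ m = fps_const (-1) ^ m * (S oo (fps_X ^ 2)) ^ m"
    by (metis power_mult_distrib)
  also have "(S oo (fps_X ^ 2)) ^ m = (S ^ m) oo (fps_X ^ 2)"
    by (rule fps_compose_power) simp
  also have "fps_const (-1) ^ m = (fps_const ((-1) ^ m) :: complex fps)"
    by (rule fps_const_power)
  also have "S ^ m = (C ^ m) oo (fps_const (-4) * fps_X)"
    by (simp add: S_def fps_compose_power)
  finally have "(inv_sinc_fps ^ m) $ n =
      (-1) ^ m * (if even n then (-4) ^ (n div 2) * (C ^ m) $ (n div 2) else 0)"
    by (simp add: fps_nth_compose_X_power fps_compose_linear)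
  moreover have "(-4 :: complex) ^ l = (-1) ^ l * 2 ^ l * 2 ^ l" for l
    by (simp flip: power_mult_distrib)
  ultimately show ?thesis
    by (simp add: gamma_coeff_conv_fps[OF assms] C_pow)
qed

section \<open>Termwise differentiation of the hyperbolic series\<close>

text \<open>This links complex derivatives, for which termwise differentiation is available, to the
  real derivatives in the theorem.\<close>

lemma higher_deriv_of_real:
  fixes F :: "complex \<Rightarrow> complex" and f :: "real \<Rightarrow> real"
  assumes holo: "F holomorphic_on S" and "open S" "open U"
    and sub: "of_real ` U \<subseteq> S" and eq: "\<And>x. x \<in> U \<Longrightarrow> F (of_real x) = of_real (f x)"
    and "x \<in> U"
  shows "(deriv ^^ p) F (of_real x) = of_real ((deriv ^^ p) f x)"
  using \<open>x \<in> U\<close>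
proof (induction p arbitrary: x)
  case (Suc p)
  define G where "G = (deriv ^^ p) F"
  define g where "g = (deriv ^^ p) f"
  have "G holomorphic_on S"
    unfolding G_def by (intro holomorphic_higher_deriv assms)
  moreover have "of_real x \<in> S" using sub Suc.prems by auto
  ultimately have "(G has_field_derivative deriv G (of_real x)) (at (of_real x))"
    using \<open>open S\<close> by (simp add: holomorphic_derivI)
  hence "((\<lambda>x. G (of_real x)) has_vector_derivative deriv G (of_real x)) (at x)"
    by (intro has_vector_derivative_real_field)
  moreover have ev: "eventually (\<lambda>x. G (of_real x) = of_real (g x)) (nhds x)"
    using eventually_nhds_in_open[OF \<open>open U\<close> Suc.prems]
    by eventually_elim (use Suc.IH in \<open>auto simp: G_def g_def\<close>)
  ultimately have *: "((\<lambda>x. complex_of_real (g x)) has_vector_derivative deriv G (of_real x)) (at x)"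
    by (subst (asm) has_vector_derivative_cong_ev[where g = "\<lambda>x. of_real (g x)"])
       (auto intro: eventually_nhds_x_imp_x)
  have re: "(g has_real_derivative Re (deriv G (of_real x))) (at x)"
    using bounded_linear.has_vector_derivative[OF bounded_linear_Re *] by (simp add: has_real_derivative_iff_has_vector_derivative)
  \<comment> \<open>Along the real axis \<open>G\<close> is real, so the imaginary part of its
    derivative is the derivative of 0.\<close>
  have "((\<lambda>x. 0) has_vector_derivative Im (deriv G (of_real x))) (at x)"
    using bounded_linear.has_vector_derivative[OF bounded_linear_Im *] by simp
  hence "Im (deriv G (of_real x)) = 0"
    using vector_derivative_unique_at has_vector_derivative_const by blast
  hence "deriv G (of_real x) = of_real (deriv g x)"
    using DERIV_imp_deriv[OF re] by (simp add: complex_eq_iff)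
  thus ?case by (simp add: G_def g_def)
qed (use eq in auto)

text \<open>Reverse triangle inequality for the two exponentials in cosh.\<close>

lemma norm_cosh_ge_sinh_Re:
  assumes "Re z \<ge> 0"
  shows "sinh (Re z) \<le> norm (cosh z)"
proof -
  have "norm (cosh z) \<ge> \<bar>norm (exp z / 2) - norm (exp (-z) / 2)\<bar>"
    using norm_triangle_ineq3[of "exp z / 2" "- exp (-z) / 2"]
    by (simp add: cosh_field_def add_divide_distrib)
  thus ?thesis by (simp add: sinh_field_def diff_divide_distrib norm_exp)
qed

lemma cosh_nonzero_Re_pos: "Re z > 0 \<Longrightarrow> cosh z \<noteq> (0::complex)"
  using norm_cosh_ge_sinh_Re[of z] sinh_real_pos_iff[of "Re z"] by auto

lemma cosh_of_real: "cosh (complex_of_real x) = of_real (cosh x)"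
  by (simp add: cosh_field_def exp_of_real flip: of_real_minus)

lemma half_odd_Suc: "half_odd (Suc n) = real n + 1 / 2"
  by (simp add: half_odd_def field_simps)

lemma holomorphic_cosh [holomorphic_intros]:
  "f holomorphic_on A \<Longrightarrow> (\<lambda>z. cosh (f z)) holomorphic_on A"
  unfolding cosh_field_def by (intro holomorphic_intros) auto

abbreviation sech_power :: "nat \<Rightarrow> complex \<Rightarrow> complex" where
  "sech_power m \<equiv> \<lambda>z. 1 / cosh z ^ m"

lemma holomorphic_sech_power: "sech_power m holomorphic_on {z. Re z > 0}"
  by (intro holomorphic_intros) (auto dest: cosh_nonzero_Re_pos)

text \<open>The series extends to a holomorphic function on a half-plane and may be differentiated
  termwise there. Each derivative brings out a factor \<open>half_odd (Suc n)\<close>, which raises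
  the exponent from \<open>s\<close> to \<open>s + p\<close>.\<close>

lemma cosh_series_deriv_sums:
  fixes a :: real and l m p :: nat
  assumes "m > 0"
  defines "s \<equiv> a + 1 + 2 * real l - real m"
  shows "(\<lambda>n. (-1) ^ (m * Suc n) * of_real (half_odd (Suc n) powr (s + real p))
                * (deriv ^^ p) (sech_power m) (of_real (half_odd (Suc n) * pi)))
           sums of_real (Lim (at pi) ((deriv ^^ p) (cosh_series a l m)))"
proof -
  define x where "x = (\<lambda>n. half_odd (Suc n))"
  have x_eq: "x n = real n + 1 / 2" for n
    by (simp add: x_def half_odd_Suc)
  hence x_pos: "x n > 0" for n by simp
  define c where "c = (\<lambda>n. (-1) ^ (m * Suc n) * x n powr s)"
  define t where "t = (\<lambda>n z. complex_of_real (c n) * sech_power m (of_real (x n) * z))"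
  \<comment> \<open>The bound 1 keeps Re z away from 0, which gives a majorant independent of
    \<open>z\<close>, and still leaves pi inside the half-plane.\<close>
  define A where "A = {z. Re z > 1}"
  have [simp]: "open A" by (simp add: A_def open_halfspace_Re_gt)
  have Re_pos: "Re (of_real (x n) * z) > 0" if "z \<in> A" for n z
    using that x_pos[of n] by (simp add: A_def)
  have t_holo: "t n holomorphic_on A" for n
    unfolding t_def by (intro holomorphic_intros) (auto dest: cosh_nonzero_Re_pos[OF Re_pos])
  have bound: "norm (t n z) \<le> x n powr s / sinh (x n) ^ m" if "z \<in> A" for n z
  proof -
    have "sinh (x n) \<le> sinh (Re (of_real (x n) * z))"
      using that x_pos[of n] by (simp add: A_def)
    also have "\<dots> \<le> norm (cosh (of_real (x n) * z))"
      using Re_pos[OF that, of n] by (intro norm_cosh_ge_sinh_Re) auto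
    finally have "sinh (x n) ^ m \<le> norm (cosh (of_real (x n) * z)) ^ m"
      using x_pos[of n] by (intro power_mono) auto
    moreover have "sinh (x n) ^ m > 0" using x_pos[of n] by simp
    ultimately show ?thesis
      by (auto simp: t_def c_def norm_mult norm_divide norm_power intro!: divide_left_mono mult_pos_pos)
  qed
  have summ: "summable (\<lambda>n. x n powr s / sinh (x n) ^ m)"
  proof (rule summable_comparison_test_ev)
    \<comment> \<open>Once sinh is at least 1, its power \<open>m\<close> may be replaced by the
      first power, and exponential growth beats any power of \<open>n\<close>.\<close>
    have "eventually (\<lambda>n. sinh (x n) \<ge> 1) at_top"
      unfolding x_eq sinh_field_def by real_asymp
    thus "eventually (\<lambda>n. norm (x n powr s / sinh (x n) ^ m) \<le> x n powr s / sinh (x n)) at_top"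
    proof eventually_elim
      case (elim n)
      hence "sinh (x n) ^ 1 \<le> sinh (x n) ^ m"
        using assms(1) by (intro power_increasing) auto
      with elim x_pos[of n] show ?case by (auto intro!: divide_left_mono mult_pos_pos)
    qed
    show "summable (\<lambda>n. x n powr s / sinh (x n))"
    proof (rule summable_comparison_test_bigo)
      show "summable (\<lambda>n. norm (1 / real n ^ 2))"
        using inverse_power_summable[of 2, where ?'a = real] by (simp add: divide_inverse)
      show "(\<lambda>n. x n powr s / sinh (x n)) \<in> O(\<lambda>n. 1 / real n ^ 2)"
        unfolding x_eq sinh_field_def by real_asymp
    qed
  qed
  define F where "F = (\<lambda>z. \<Sum>n. t n z)"
  have ulim: "uniform_limit A (\<lambda>N z. \<Sum>n<N. t n z) F sequentially"
    unfolding F_def by (rule Weierstrass_m_test[OF bound summ])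
  have F_holo: "F holomorphic_on A"
  proof (rule holomorphic_uniform_sequence[where f = "\<lambda>N z. \<Sum>n<N. t n z"])
    fix z assume "z \<in> A"
    then obtain d where "d > 0" "cball z d \<subseteq> A"
      using \<open>open A\<close> open_contains_cball by blast
    thus "\<exists>d>0. cball z d \<subseteq> A \<and>
            uniform_limit (cball z d) (\<lambda>N z. \<Sum>n<N. t n z) F sequentially"
      using ulim uniform_limit_on_subset by blast
  qed (auto intro!: holomorphic_intros t_holo)
  have summable_t: "summable (\<lambda>n. t n z)" if "z \<in> A" for z
    by (rule summable_comparison_test'[OF summ]) (use bound[OF that] in auto)
  have F_real: "F (of_real y) = of_real (cosh_series a l m y)" if "y > 1" for y
  proof -
    have t_real: "t n (of_real y) = of_real (c n / cosh (x n * y) ^ m)" for n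
      by (simp add: t_def flip: cosh_of_real)
    have "summable (\<lambda>n. t n (of_real y))"
      using that by (intro summable_t) (auto simp: A_def)
    hence "summable (\<lambda>n. c n / cosh (x n * y) ^ m)"
      unfolding t_real by (simp only: summable_complex_of_real)
    from suminf_of_real[OF this, where ?'a = complex] show ?thesis
      unfolding F_def cosh_series_def t_real by (simp add: c_def x_def s_def)
  qed
  have real_deriv: "(deriv ^^ p) F (of_real y) = of_real ((deriv ^^ p) (cosh_series a l m) y)"
    if "y > 1" for y
    by (rule higher_deriv_of_real[OF F_holo \<open>open A\<close>, where U = "{1<..}"])
       (use that F_real in \<open>auto simp: A_def\<close>)
  have pi_gt: "pi > 1" using pi_gt3 by simp
  \<comment> \<open>The limit y -> pi in the theorem is just the value at pi, because the derivative
    is the restriction of a holomorphic function.\<close>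
  have "((deriv ^^ p) (cosh_series a l m) \<longlongrightarrow> (deriv ^^ p) (cosh_series a l m) pi) (at pi)"
  proof -
    have "(deriv ^^ p) F holomorphic_on A"
      by (intro holomorphic_higher_deriv F_holo) auto
    hence "isCont ((deriv ^^ p) F) (of_real pi)"
      using pi_gt by (intro continuous_on_interior[OF holomorphic_on_imp_continuous_on])
                     (auto simp: interior_open A_def[symmetric], simp add: A_def)
    hence "((\<lambda>y. (deriv ^^ p) F (of_real y)) \<longlongrightarrow> (deriv ^^ p) F (of_real pi)) (at pi)"
      by (intro isCont_tendsto_compose[where g = "(deriv ^^ p) F"] tendsto_intros) auto
    hence "((\<lambda>y. Re ((deriv ^^ p) F (of_real y))) \<longlongrightarrow> Re ((deriv ^^ p) F (of_real pi))) (at pi)"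
      by (intro tendsto_intros)
    moreover have "eventually (\<lambda>y. Re ((deriv ^^ p) F (of_real y)) = (deriv ^^ p) (cosh_series a l m) y) (at pi)"
      using eventually_at_in_open'[of "{1<..}" pi] pi_gt
      by (auto elim!: eventually_mono simp: real_deriv)
    ultimately show ?thesis
      using pi_gt by (simp add: real_deriv tendsto_cong)
  qed
  hence Lim_eq: "Lim (at pi) ((deriv ^^ p) (cosh_series a l m)) = (deriv ^^ p) (cosh_series a l m) pi"
    by (intro tendsto_Lim) auto
  have pi_A: "of_real pi \<in> A" using pi_gt by (simp add: A_def)
  \<comment> \<open>Uniform convergence of holomorphic functions passes to all derivatives, by the
    Weierstrass convergence theorem.\<close>
  have "(\<lambda>N. (deriv ^^ p) (\<lambda>z. \<Sum>n<N. t n z) (of_real pi)) \<longlonglongrightarrow> (deriv ^^ p) F (of_real pi)"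
    by (rule higher_deriv_complex_uniform_limit[OF ulim _ _ _ pi_A])
       (auto intro!: always_eventually holomorphic_intros t_holo)
  also have "(\<lambda>N. (deriv ^^ p) (\<lambda>z. \<Sum>n<N. t n z) (of_real pi)) =
             (\<lambda>N. \<Sum>n<N. (deriv ^^ p) (t n) (of_real pi))"
  proof
    fix N
    show "(deriv ^^ p) (\<lambda>z. \<Sum>n<N. t n z) (of_real pi) = (\<Sum>n<N. (deriv ^^ p) (t n) (of_real pi))"
    proof (induction N)
      case (Suc N)
      thus ?case
        using higher_deriv_add[of "\<lambda>z. \<Sum>n<N. t n z" A "t N" "of_real pi" p] pi_A
        by (simp add: t_holo holomorphic_on_sum)
    qed (simp add: higher_deriv_const)
  qed
  finally have "(\<lambda>n. (deriv ^^ p) (t n) (of_real pi)) sums of_real (Lim (at pi) ((deriv ^^ p) (cosh_series a l m)))"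
    using real_deriv[OF pi_gt] by (simp add: sums_def Lim_eq)
  moreover have "(deriv ^^ p) (t n) (of_real pi) =
      (-1) ^ (m * Suc n) * of_real (x n powr (s + real p)) * (deriv ^^ p) (sech_power m) (of_real (x n * pi))" for n
  proof -
    have "(deriv ^^ p) (t n) (of_real pi) =
          of_real (c n) * (deriv ^^ p) (\<lambda>z. sech_power m (of_real (x n) * z)) (of_real pi)"
      unfolding t_def
      by (rule higher_deriv_cmult[OF _ pi_A])
         (auto intro!: holomorphic_intros dest: cosh_nonzero_Re_pos[OF Re_pos])
    also have "(deriv ^^ p) (\<lambda>z. sech_power m (of_real (x n) * z)) (of_real pi) =
          of_real (x n) ^ p * (deriv ^^ p) (sech_power m) (of_real (x n) * of_real pi)"
      by (rule higher_deriv_compose_linear[OF holomorphic_sech_power _ _ pi_A])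
         (use Re_pos in \<open>auto simp: open_halfspace_Re_gt\<close>)
    finally show ?thesis
      using x_pos[of n] by (simp add: c_def powr_add powr_realpow)
  qed
  ultimately show ?thesis by (simp add: x_def)
qed

section \<open>Residues\<close>

definition cos_cosh_integrand :: "real \<Rightarrow> nat \<Rightarrow> complex \<Rightarrow> complex" where
  "cos_cosh_integrand a m z = z powr of_real a / (cos z + cosh z) ^ m"

text \<open>Indices start at 0, so both coordinates of the pole are (n + 1/2) pi.\<close>

definition cos_cosh_pole :: "nat \<Rightarrow> complex" where
  "cos_cosh_pole n = (1 + \<i>) * of_real (half_odd (Suc n) * pi)"

section \<open>Factorisation of the denominator\<close>

lemma cosh_conv_cos_complex: "cosh z = cos (\<i> * z)" for z :: complex
  by (simp add: cos_exp_eq cosh_field_def)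

text \<open>The sum-to-product formula for cos z + cos (iz). The first factor vanishes only on the
  line spanned by 1 - i, the second only on the diagonal spanned by 1 + i.\<close>

lemma cos_plus_cosh_complex:
  "cos z + cosh z = 2 * cos ((1 + \<i>) / 2 * z) * cos ((1 - \<i>) / 2 * z)" for z :: complex
proof -
  have "cos z + cos (\<i> * z) = 2 * cos ((z + \<i> * z) / 2) * cos ((z - \<i> * z) / 2)"
    by (rule cos_plus_cos)
  thus ?thesis by (simp add: cosh_conv_cos_complex algebra_simps add_divide_distrib diff_divide_distrib)
qed

lemma sin_half_odd_pi: "sin (half_odd (Suc n) * pi) = (-1) ^ n"
  by (simp add: half_odd_Suc ring_distribs sin_add)

lemma cos_half_odd_pi: "cos (half_odd (Suc n) * pi) = 0"
  by (simp add: half_odd_Suc ring_distribs cos_add)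

text \<open>The substitution \<open>z = (1 + \<i>) v\<close> maps the poles to the points \<open>(n + 1/2) \<pi>\<close>.\<close>
lemma cos_plus_cosh_near_pole:
  fixes n :: nat and u :: complex
  defines "x0 \<equiv> half_odd (Suc n) * pi"
  shows "cos ((1 + \<i>) * (of_real x0 + u)) + cosh ((1 + \<i>) * (of_real x0 + u)) =
           2 * (-1) ^ Suc n * sin u * cosh (of_real x0 + u)"
proof -
  define v where "v = of_real x0 + u"
  have 1: "(1 + \<i>) / 2 * ((1 + \<i>) * v) = \<i> * v" and 2: "(1 - \<i>) / 2 * ((1 + \<i>) * v) = v"
    by (simp_all add: field_simps)
  have "sin (complex_of_real x0) = (-1) ^ n" "cos (complex_of_real x0) = 0"
    unfolding x0_def sin_of_real cos_of_real
    by (simp_all only: sin_half_odd_pi cos_half_odd_pi of_real_power of_real_minus of_real_1 of_real_0)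
  hence cos_v: "cos v = (-1) ^ Suc n * sin u"
    by (simp add: v_def cos_add)
  show ?thesis
    unfolding v_def[symmetric] cos_plus_cosh_complex 1 2 cos_v
    by (simp add: cosh_conv_cos_complex)
qed

text \<open>Both arguments lie strictly between -pi/2 and pi/2, so the principal logarithms add
  without a jump.\<close>

lemma powr_times_1_plus_ii:
  assumes "Re v > 0"
  shows "((1 + \<i>) * v) powr s = (1 + \<i>) powr s * v powr s"
proof -
  have nz: "v \<noteq> 0" "1 + \<i> \<noteq> 0" using assms by (auto simp: complex_eq_iff)
  have "\<bar>Im (Ln v)\<bar> < pi / 2"
    using assms Re_Ln_pos_lt[OF nz(1)] by blast
  moreover have "\<bar>Im (Ln (1 + \<i>))\<bar> < pi / 2"
    using Re_Ln_pos_lt[OF nz(2)] by force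
  ultimately have "Ln ((1 + \<i>) * v) = Ln (1 + \<i>) + Ln v"
    using nz by (intro Ln_times_simple) auto
  thus ?thesis
    using nz by (simp add: powr_def distrib_left exp_add)
qed

text \<open>The Taylor series of \<open>(x + u) powr a\<close> in \<open>u\<close>, for
  \<open>x > 0\<close>.\<close>

definition shifted_powr_fps :: "real \<Rightarrow> real \<Rightarrow> complex fps" where
  "shifted_powr_fps a x = Abs_fps (\<lambda>j. of_real ((a gchoose j) * x powr (a - real j)))"

lemma of_real_gbinomial: "complex_of_real (a gchoose j) = of_real a gchoose j"
  by (simp add: gbinomial_prod_rev)

text \<open>Binomial series for x^a (1 + u/x)^a; a positive real factor can be split off a principal
  power for every \<open>u\<close>.\<close>

lemma has_fps_expansion_shifted_powr:
  assumes "x > 0"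
  shows "(\<lambda>u. (of_real x + u) powr of_real a) has_fps_expansion shifted_powr_fps a x"
proof -
  let ?f = "\<lambda>u. (1 + u) powr complex_of_real a"
  have lin: "(\<lambda>u::complex. of_real (1 / x) * u) has_fps_expansion fps_const (of_real (1 / x)) * fps_X"
    by (intro fps_expansion_intros)
  have "(?f \<circ> (\<lambda>u. of_real (1 / x) * u)) has_fps_expansion
          (fps_binomial (of_real a) oo (fps_const (of_real (1 / x)) * fps_X))"
    by (rule has_fps_expansion_compose[OF has_fps_expansion_binomial_complex lin]) simp
  hence 1: "(\<lambda>u. of_real (x powr a) * ?f (of_real (1 / x) * u)) has_fps_expansion
          fps_const (of_real (x powr a)) * (fps_binomial (of_real a) oo (fps_const (of_real (1 / x)) * fps_X))"
    by (intro fps_expansion_intros) (simp add: o_def)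
  have 2: "fps_const (of_real (x powr a)) * (fps_binomial (of_real a) oo (fps_const (of_real (1 / x)) * fps_X))
          = shifted_powr_fps a x"
    using assms
    by (intro fps_ext, subst fps_compose_linear)
       (simp add: shifted_powr_fps_def of_real_gbinomial powr_diff powr_realpow power_divide)
  have 3: "of_real (x powr a) * ?f (of_real (1 / x) * u) = (of_real x + u) powr of_real a" for u
  proof -
    have "(of_real x * (1 + of_real (1 / x) * u)) powr complex_of_real a =
          of_real x powr of_real a * (1 + of_real (1 / x) * u) powr of_real a"
      using assms by (intro powr_times_real_left) auto
    thus ?thesis using assms by (simp add: ring_distribs powr_of_real)
  qed
  from 1 show ?thesis unfolding 2 3 .
qed

lemma has_fps_expansion_inv_sinc:
  "(\<lambda>u. if u = 0 then 1 else u / sin u) has_fps_expansion inv_sinc_fps"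
proof -
  have sd: "subdegree (fps_sin 1 :: complex fps) = 1"
    by (rule subdegreeI) auto
  thus ?thesis
    unfolding inv_sinc_fps_def by (intro fps_expansion_intros) auto
qed

text \<open>The coefficient of u^(m-1) in (x + u)^a (u / sin u)^m / cosh^m (x + u) at
  \<open>x = half_odd (Suc n) * pi\<close>: degree \<open>2 * l\<close> is taken from the sine
  factor, \<open>j\<close> from the power, and the rest from the Taylor series of
  \<open>sech_power m\<close>.\<close>

definition pole_coeff :: "real \<Rightarrow> nat \<Rightarrow> nat \<Rightarrow> complex" where
  "pole_coeff a m n = (\<Sum>l=0..(m - 1) div 2. \<Sum>j=0..m - 1 - 2 * l.
     of_real ((-1) ^ l * 2 ^ l * gamma_coeff l m * (a gchoose j)
        * (half_odd (Suc n) * pi) powr (a - real j) / fact (m - 1 - 2 * l - j))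
     * (deriv ^^ (m - 1 - 2 * l - j)) (sech_power m) (of_real (half_odd (Suc n) * pi)))"

lemma residue_cos_cosh_integrand:
  assumes "m > 0"
  shows "residue (cos_cosh_integrand a m) (cos_cosh_pole n) =
           (1 + \<i>) powr of_real a * (1 + \<i>) * (-1) ^ (m * Suc n) / 2 ^ m * pole_coeff a m n"
proof -
  define x where "x = half_odd (Suc n) * pi"
  have x: "x > 0" by (simp add: x_def half_odd_Suc add_pos_pos)
  \<comment> \<open>A displacement \<open>w\<close> from the pole corresponds to
    \<open>u = c * w\<close> in the rotated coordinate.\<close>
  define c where "c = 1 / (1 + \<i>)"
  have nz: "1 + \<i> \<noteq> 0" by (simp add: complex_eq_iff)
  hence c: "c \<noteq> 0" "(1 + \<i>) * c = 1" by (simp_all add: c_def)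
  define B where "B = fps_expansion (sech_power m) (of_real x)"
  have "sech_power m analytic_on {of_real x}"
    using x holomorphic_sech_power open_halfspace_Re_gt[of 0]
    by (auto simp: analytic_at)
  hence B: "(\<lambda>u. sech_power m (of_real x + u)) has_fps_expansion B"
    unfolding B_def by (rule analytic_at_imp_has_fps_expansion)
  define k where "k = (\<lambda>u. (of_real x + u) powr of_real a * sech_power m (of_real x + u)
                        * (if u = 0 then 1 else u / sin u) ^ m)"
  define K where "K = shifted_powr_fps a x * B * inv_sinc_fps ^ m"
  have k: "k has_fps_expansion K"
    unfolding k_def K_def
    by (intro has_fps_expansion_mult has_fps_expansion_power B has_fps_expansion_inv_sinc
              has_fps_expansion_shifted_powr x)
  have lin: "(\<lambda>w::complex. c * w) has_fps_expansion fps_const c * fps_X"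
    by (intro fps_expansion_intros)
  define C where "C = (1 + \<i>) powr of_real a * (-1) ^ (m * Suc n) / 2 ^ m"
  have kc: "(\<lambda>w. C / c ^ m * k (c * w)) has_fps_expansion
             fps_const (C / c ^ m) * (K oo (fps_const c * fps_X))"
    using has_fps_expansion_compose[OF k lin]
    by (intro fps_expansion_intros) (simp add: o_def)
  have "residue (cos_cosh_integrand a m) (cos_cosh_pole n) =
        residue (\<lambda>w. cos_cosh_integrand a m (cos_cosh_pole n + w)) 0"
    by (rule residue_shift_0)
  also have "\<dots> = residue (\<lambda>w. C / c ^ m * k (c * w) / w ^ Suc (m - 1)) 0"
  proof (rule residue_cong)
    \<comment> \<open>Near the pole the rotated point stays in the right half-plane, where
      \<open>powr_times_1_plus_ii\<close> applies.\<close>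
    have "eventually (\<lambda>w. w \<in> {w. Re (of_real x + c * w) > 0}) (nhds 0)"
      using x by (intro eventually_nhds_in_open open_Collect_less continuous_intros) auto
    hence "eventually (\<lambda>w. Re (of_real x + c * w) > 0 \<and> w \<noteq> 0) (at 0)"
      by (auto simp: eventually_at_filter elim: eventually_mono)
    thus "eventually (\<lambda>w. cos_cosh_integrand a m (cos_cosh_pole n + w) =
            C / c ^ m * k (c * w) / w ^ Suc (m - 1)) (at 0)"
    proof eventually_elim
      case (elim w)
      define u where "u = c * w"
      have w: "w = (1 + \<i>) * u" using c by (simp add: u_def flip: mult.assoc)
      have z: "cos_cosh_pole n + w = (1 + \<i>) * (of_real x + u)"
        by (simp add: cos_cosh_pole_def w x_def ring_distribs)
      have "u \<noteq> 0" using elim c by (simp add: u_def)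
      have "cos_cosh_integrand a m (cos_cosh_pole n + w) =
            (1 + \<i>) powr of_real a * (of_real x + u) powr of_real a /
              (2 * (-1) ^ Suc n * sin u * cosh (of_real x + u)) ^ m"
        unfolding cos_cosh_integrand_def z
        using elim cos_plus_cosh_near_pole[of n u] by (simp add: powr_times_1_plus_ii u_def x_def)
      also have "\<dots> = C / u ^ m * k u"
      proof -
        have "(2 * (-1) ^ Suc n * sin u * cosh (of_real x + u)) ^ m =
              2 ^ m * (-1) ^ (m * Suc n) * sin u ^ m * cosh (of_real x + u) ^ m"
          by (simp only: power_mult_distrib power_mult[symmetric] mult.commute[of m])
        \<comment> \<open>The sign is its own inverse and so moves from the denominator to the
          numerator.\<close>
        moreover have "(-1 :: complex) ^ (m * Suc n) * (-1) ^ (m * Suc n) = 1"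
          by (simp flip: power_mult_distrib)
        ultimately show ?thesis
          using \<open>u \<noteq> 0\<close> by (simp add: C_def k_def power_divide divide_simps)
      qed
      also have "\<dots> = C / c ^ m * k (c * w) / w ^ Suc (m - 1)"
        using assms by (simp add: u_def power_mult_distrib)
      finally show ?case .
    qed
  qed auto
  also have "\<dots> = (fps_const (C / c ^ m) * (K oo (fps_const c * fps_X))) $ (m - 1)"
    by (rule residue_fps_expansion_over_power_at_0[OF kc])
  also have "\<dots> = C / c ^ m * c ^ (m - 1) * K $ (m - 1)"
    by (simp add: fps_compose_linear)
  \<comment> \<open>The factor 1 + i left over is dz/du.\<close>
  also have "C / c ^ m * c ^ (m - 1) = C * (1 + \<i>)"
    using assms c nz by (cases m) (simp_all add: c_def field_simps)
  also have "K $ (m - 1) = pole_coeff a m n"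
  proof -
    define Q where "Q = shifted_powr_fps a x * B"
    have "K $ (m - 1) = (\<Sum>i=0..m - 1. (inv_sinc_fps ^ m) $ i * Q $ (m - 1 - i))"
      by (simp add: K_def Q_def mult.commute[of _ "inv_sinc_fps ^ m"] fps_mult_nth)
    also have "\<dots> = (\<Sum>i | i \<in> {0..m - 1} \<and> even i. (inv_sinc_fps ^ m) $ i * Q $ (m - 1 - i))"
      by (rule sum.mono_neutral_right) (auto simp: inv_sinc_fps_power_nth[OF assms])
    also have "\<dots> = (\<Sum>l=0..(m - 1) div 2. (inv_sinc_fps ^ m) $ (2 * l) * Q $ (m - 1 - 2 * l))"
      by (rule sum.reindex_bij_witness[of _ "\<lambda>l. 2 * l" "\<lambda>i. i div 2"]) auto
    also have "\<dots> = pole_coeff a m n"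
      unfolding pole_coeff_def
    proof (rule sum.cong)
      fix l assume "l \<in> {0..(m - 1) div 2}"
      show "(inv_sinc_fps ^ m) $ (2 * l) * Q $ (m - 1 - 2 * l) = (\<Sum>j=0..m - 1 - 2 * l.
     of_real ((-1) ^ l * 2 ^ l * gamma_coeff l m * (a gchoose j)
        * (half_odd (Suc n) * pi) powr (a - real j) / fact (m - 1 - 2 * l - j))
     * (deriv ^^ (m - 1 - 2 * l - j)) (sech_power m) (of_real (half_odd (Suc n) * pi)))"
        unfolding Q_def fps_mult_nth sum_distrib_left
        by (intro sum.cong refl)
           (simp add: inv_sinc_fps_power_nth[OF assms] shifted_powr_fps_def B_def
                      fps_expansion_def x_def)
    qed auto
    finally show ?thesis .
  qed
  finally show ?thesis by (simp add: C_def)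
qed

section \<open>The contour integral\<close>

text \<open>All zeros of cos are real. For the first factor this means Re z + Im z = 0, hence z = 0
  in the quadrant, where cos is 1; so the second factor vanishes, and Re z >= 0 excludes the
  negative indices.\<close>

lemma cos_plus_cosh_eq_0_quadrant:
  assumes "cos z + cosh z = 0" "Re z \<ge> 0" "Im z \<ge> 0"
  shows "\<exists>n. z = cos_cosh_pole n"
proof -
  define w where "w = (1 + \<i>) / 2 * z"
  define v where "v = (1 - \<i>) / 2 * z"
  have z: "z = (1 + \<i>) * v" by (simp add: v_def field_simps)
  have "cos w \<noteq> 0"
  proof
    assume *: "cos w = 0"
    then obtain k :: int where "w = of_real (k * pi) + of_real pi / 2"
      unfolding cos_eq_0 by blast
    hence "Im w = 0" by simp
    hence "Re z = 0" "Im z = 0" using assms by (auto simp: w_def)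
    hence "w = 0" by (simp add: w_def complex_eq_iff)
    with * show False by simp
  qed
  hence "cos v = 0"
    using assms(1) cos_plus_cosh_complex[of z] by (simp add: w_def v_def)
  then obtain k :: int where k: "v = of_real (k * pi) + of_real pi / 2"
    unfolding cos_eq_0 by blast
  hence "Re z = k * pi + pi / 2" by (simp add: z)
  hence "(real_of_int k + 1 / 2) * pi \<ge> 0" using assms by (simp add: ring_distribs)
  hence "real_of_int k + 1 / 2 \<ge> 0" using pi_gt_zero by (simp only: zero_le_mult_iff) linarith
  hence "k \<ge> 0" by linarith
  hence "v = of_real (half_odd (Suc (nat k)) * pi)"
    by (simp add: k half_odd_Suc ring_distribs)
  thus ?thesis using z unfolding cos_cosh_pole_def by blast
qed

lemma Re_cos_cosh_pole [simp]: "Re (cos_cosh_pole n) = (real n + 1 / 2) * pi"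
  and Im_cos_cosh_pole [simp]: "Im (cos_cosh_pole n) = (real n + 1 / 2) * pi"
  by (simp_all add: cos_cosh_pole_def half_odd_Suc)

lemma inj_cos_cosh_pole: "inj cos_cosh_pole"
  by (rule injI) (use Re_cos_cosh_pole in \<open>metis add_right_cancel mult_right_cancel of_nat_eq_iff pi_neq_zero\<close>)

definition pole_free_quadrant :: "complex set" where
  "pole_free_quadrant = {z. Re z \<ge> 0 \<and> Im z \<ge> 0 \<and> cos z + cosh z \<noteq> 0}"

lemma continuous_on_cosh_complex: "continuous_on A (cosh :: complex \<Rightarrow> complex)"
  unfolding cosh_field_def by (intro continuous_intros) auto

text \<open>The closed quadrant avoids the branch cut, and \<open>a > 0\<close> makes the power
  continuous at 0 as well.\<close>

lemma continuous_on_cos_cosh_integrand: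
  assumes "a > 0"
  shows "continuous_on pole_free_quadrant (cos_cosh_integrand a m)"
  unfolding cos_cosh_integrand_def using assms
  by (intro continuous_intros continuous_on_cosh_complex) (auto simp: pole_free_quadrant_def)

text \<open>Every boundary point has a coordinate equal to \<delta> <= 1 < pi/2 or to N pi, whereas
  both coordinates of a pole are odd multiples of pi/2.\<close>

lemma rectpath_pole_free:
  assumes "0 \<le> \<delta>" "\<delta> \<le> 1" "N > 0"
  defines "R \<equiv> real N * pi"
  shows "path_image (rectpath (Complex \<delta> \<delta>) (Complex R R)) \<subseteq> pole_free_quadrant"
proof
  have "R \<ge> 1 * pi" unfolding R_def using assms(3) by (intro mult_right_mono) auto
  hence R: "R > 1" using pi_gt3 by linarith
  fix z assume "z \<in> path_image (rectpath (Complex \<delta> \<delta>) (Complex R R))"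
  hence z: "Re z \<ge> 0" "Im z \<ge> 0" "Re z \<in> {\<delta>, R} \<or> Im z \<in> {\<delta>, R}"
    using assms R by (auto simp: path_image_rectpath)
  have "z \<noteq> cos_cosh_pole n" for n
  proof
    assume *: "z = cos_cosh_pole n"
    have "(real n + 1 / 2) * pi \<ge> 1 / 2 * pi"
      by (intro mult_right_mono) auto
    hence "(real n + 1 / 2) * pi > 1" using pi_gt3 by linarith
    moreover have "(real n + 1 / 2) * pi \<noteq> R"
    proof
      assume "(real n + 1 / 2) * pi = R"
      hence "real n + 1 / 2 = real N" by (simp add: R_def)
      hence "real (2 * n + 1) = real (2 * N)" by simp
      thus False by (simp only: of_nat_eq_iff) presburger
    qed
    ultimately show False using z(3) assms(2) unfolding * by auto
  qed
  thus "z \<in> pole_free_quadrant"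
    using z cos_plus_cosh_eq_0_quadrant[of z] by (auto simp: pole_free_quadrant_def)
qed

lemma contour_integral_rectpath_pos:
  assumes "0 < \<delta>" "\<delta> \<le> 1" "N > 0"
  defines "R \<equiv> real N * pi"
  shows "contour_integral (rectpath (Complex \<delta> \<delta>) (Complex R R)) (cos_cosh_integrand a m) =
           2 * pi * \<i> * (\<Sum>n<N. residue (cos_cosh_integrand a m) (cos_cosh_pole n))"
proof -
  \<comment> \<open>Open, clear of the branch cut, and, because 1 < pi/2, containing no poles beyond
    the first \<open>N\<close>.\<close>
  define S where "S = box 0 (Complex (R + 1) (R + 1))"
  define pts where "pts = cos_cosh_pole ` {..<N}"
  let ?g = "rectpath (Complex \<delta> \<delta>) (Complex R R)"
  have "R \<ge> 1 * pi" unfolding R_def using assms(3) by (intro mult_right_mono) auto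
  hence R: "R > 3" using pi_gt3 by linarith
  have pole_in: "cos_cosh_pole n \<in> box (Complex \<delta> \<delta>) (Complex R R)" if "n < N" for n
  proof -
    have "(real n + 1 / 2) * pi \<ge> 1 / 2 * pi" by (intro mult_right_mono) auto
    hence "(real n + 1 / 2) * pi > \<delta>" using pi_gt3 assms(2) by linarith
    moreover have "(real n + 1 / 2) * pi < R"
      unfolding R_def using that by (intro mult_strict_right_mono) auto
    ultimately show ?thesis by (simp add: in_box_complex_iff)
  qed
  have nz: "cos z + cosh z \<noteq> 0" if z: "z \<in> S - pts" for z
  proof
    assume "cos z + cosh z = 0"
    then obtain n where n: "z = cos_cosh_pole n"
      using z cos_plus_cosh_eq_0_quadrant[of z] by (auto simp: S_def in_box_complex_iff)
    have "(real n + 1 / 2) * pi < R + 1" using z by (simp add: n S_def in_box_complex_iff)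
    also have "\<dots> < (real N + 1 / 2) * pi" using pi_gt3 by (simp add: R_def ring_distribs)
    finally have "n < N" by simp
    with z n show False by (auto simp: pts_def)
  qed
  have "contour_integral ?g (cos_cosh_integrand a m) =
          2 * pi * \<i> * (\<Sum>p\<in>pts. winding_number ?g p * residue (cos_cosh_integrand a m) p)"
  proof (rule Residue_theorem)
    show "open S" "connected S" by (auto simp: S_def intro: convex_connected)
    show "finite pts" by (simp add: pts_def)
    show "cos_cosh_integrand a m holomorphic_on S - pts"
      unfolding cos_cosh_integrand_def
      by (intro holomorphic_intros)
         (auto simp: nz S_def in_box_complex_iff complex_nonpos_Reals_iff)
    show "valid_path ?g" "pathfinish ?g = pathstart ?g" by auto
    have "path_image ?g \<subseteq> S"
      using assms R by (auto simp: path_image_rectpath S_def in_box_complex_iff)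
    moreover have "path_image ?g \<inter> pts = {}"
      using path_image_rectpath_inter_box[of "Complex \<delta> \<delta>" "Complex R R"] R assms pole_in
      by (auto simp: pts_def)
    ultimately show "path_image ?g \<subseteq> S - pts" by auto
    show "\<forall>z. z \<notin> S \<longrightarrow> winding_number ?g z = 0"
      using assms R
      by (auto intro!: winding_number_rectpath_outside simp: S_def in_box_complex_iff in_cbox_complex_iff)
  qed
  also have "(\<Sum>p\<in>pts. winding_number ?g p * residue (cos_cosh_integrand a m) p) =
             (\<Sum>n<N. residue (cos_cosh_integrand a m) (cos_cosh_pole n))"
    unfolding pts_def using pole_in
    by (subst sum.reindex) (auto intro: inj_on_subset[OF inj_cos_cosh_pole] simp: winding_number_rectpath)
  finally show ?thesis .
qed

section \<open>Dependence of the contour integral on the corner of the square\<close>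

lemma contour_integral_rectpath_split:
  assumes "continuous_on (path_image (rectpath a c)) f"
  defines "b \<equiv> Complex (Re c) (Im a)" and "d \<equiv> Complex (Re a) (Im c)"
  shows "contour_integral (rectpath a c) f =
           contour_integral (linepath a b) f + contour_integral (linepath b c) f +
           contour_integral (linepath c d) f + contour_integral (linepath d a) f"
proof -
  have "path_image (rectpath a c) =
          closed_segment a b \<union> closed_segment b c \<union> closed_segment c d \<union> closed_segment d a"
    by (simp add: rectpath_def Let_def path_image_join Un_assoc b_def d_def)
  hence "f contour_integrable_on linepath p q"
    if "(p, q) \<in> {(a, b), (b, c), (c, d), (d, a)}" for p q
    using that by (intro contour_integrable_continuous_linepath continuous_on_subset[OF assms(1)]) auto
  thus ?thesis
    by (simp add: rectpath_def Let_def add.assoc flip: b_def d_def)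
qed

text \<open>Over the fixed parameter interval [0, 1] this is continuity of an integral with respect
  to a parameter; it lets the corner of the square move to 0.\<close>

lemma continuous_on_contour_integral_linepath:
  fixes p q :: "'a::topological_space \<Rightarrow> complex"
  assumes f: "continuous_on K f" and p: "continuous_on U p" and q: "continuous_on U q"
    and sub: "\<And>x. x \<in> U \<Longrightarrow> closed_segment (p x) (q x) \<subseteq> K"
  shows "continuous_on U (\<lambda>x. contour_integral (linepath (p x) (q x)) f)"
proof -
  have "continuous_on (U \<times> cbox 0 1) (\<lambda>z. f (linepath (p (fst z)) (q (fst z)) (snd z)) * (q (fst z) - p (fst z)))"
  proof (intro continuous_intros continuous_on_compose2[OF f] continuous_on_compose2[OF p] continuous_on_compose2[OF q])
    show "continuous_on (U \<times> cbox 0 1) (\<lambda>z. linepath (p (fst z)) (q (fst z)) (snd z))"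
      unfolding linepath_def
      by (intro continuous_intros continuous_on_compose2[OF p] continuous_on_compose2[OF q]) auto
    show "(\<lambda>z. linepath (p (fst z)) (q (fst z)) (snd z)) ` (U \<times> cbox 0 1) \<subseteq> K"
      using sub linepath_in_path by fastforce
  qed auto
  hence "continuous_on U (\<lambda>x. integral (cbox 0 1) (\<lambda>t. f (linepath (p x) (q x) t) * (q x - p x)))"
    by (intro integral_continuous_on_param) (simp add: case_prod_unfold)
  thus ?thesis by (simp add: contour_integral_integral)
qed

text \<open>The branch point 0 is a corner of the square, so the residue theorem only applies to squares
  with lower left corner \<open>\<delta> (1 + \<i>)\<close>, \<open>\<delta> > 0\<close>.\<close>
lemma contour_integral_rectpath_0:
  assumes "a > 0" "N > 0"
  defines "R \<equiv> real N * pi"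
  shows "contour_integral (rectpath 0 (Complex R R)) (cos_cosh_integrand a m) =
           2 * pi * \<i> * (\<Sum>n<N. residue (cos_cosh_integrand a m) (cos_cosh_pole n))"
proof -
  let ?f = "cos_cosh_integrand a m"
  let ?g = "\<lambda>\<delta>. rectpath (Complex \<delta> \<delta>) (Complex R R)"
  have sub: "path_image (?g \<delta>) \<subseteq> pole_free_quadrant" if "\<delta> \<in> {0..1}" for \<delta>
    using rectpath_pole_free[of \<delta> N] that assms by auto
  have "path_image (?g \<delta>) = closed_segment (Complex \<delta> \<delta>) (Complex R \<delta>) \<union>
           closed_segment (Complex R \<delta>) (Complex R R) \<union>
           closed_segment (Complex R R) (Complex \<delta> R) \<union> closed_segment (Complex \<delta> R) (Complex \<delta> \<delta>)" for \<delta>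
    by (simp add: rectpath_def Let_def path_image_join Un_assoc)
  with sub have segs:
    "closed_segment (Complex \<delta> \<delta>) (Complex R \<delta>) \<subseteq> pole_free_quadrant"
    "closed_segment (Complex R \<delta>) (Complex R R) \<subseteq> pole_free_quadrant"
    "closed_segment (Complex R R) (Complex \<delta> R) \<subseteq> pole_free_quadrant"
    "closed_segment (Complex \<delta> R) (Complex \<delta> \<delta>) \<subseteq> pole_free_quadrant" if "\<delta> \<in> {0..1}" for \<delta>
    using that by auto
  have c1: "continuous_on {0..1} (\<lambda>\<delta>. contour_integral (linepath (Complex \<delta> \<delta>) (Complex R \<delta>)) ?f +
            contour_integral (linepath (Complex R \<delta>) (Complex R R)) ?f +
            contour_integral (linepath (Complex R R) (Complex \<delta> R)) ?f +
            contour_integral (linepath (Complex \<delta> R) (Complex \<delta> \<delta>)) ?f)"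
    using segs
    by (intro continuous_on_add continuous_on_contour_integral_linepath[OF continuous_on_cos_cosh_integrand]
          continuous_intros assms) auto
  have c2: "contour_integral (?g \<delta>) ?f = contour_integral (linepath (Complex \<delta> \<delta>) (Complex R \<delta>)) ?f +
            contour_integral (linepath (Complex R \<delta>) (Complex R R)) ?f +
            contour_integral (linepath (Complex R R) (Complex \<delta> R)) ?f +
            contour_integral (linepath (Complex \<delta> R) (Complex \<delta> \<delta>)) ?f" if "\<delta> \<in> {0..1}" for \<delta>
    by (subst contour_integral_rectpath_split)
       (use continuous_on_subset[OF continuous_on_cos_cosh_integrand[OF assms(1)] sub[OF that]] in auto)
  have "continuous_on {0..1} (\<lambda>\<delta>. contour_integral (?g \<delta>) ?f)"
    by (rule continuous_on_eq[OF c1]) (simp add: c2)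
  hence cont: "continuous_on (closure {0<..1}) (\<lambda>\<delta>. contour_integral (?g \<delta>) ?f)"
    by simp
  \<comment> \<open>The integral is constant for 0 < \<delta> <= 1 and continuous on the closure, so
    it has the same value at 0.\<close>
  have "contour_integral (?g 0) ?f = 2 * pi * \<i> * (\<Sum>n<N. residue ?f (cos_cosh_pole n))"
    by (rule continuous_constant_on_closure[OF cont])
       (use assms contour_integral_rectpath_pos in \<open>auto simp: R_def\<close>)
  moreover have "Complex 0 0 = 0" by (simp add: complex_eq_iff)
  ultimately show ?thesis by simp
qed

section \<open>Lower bounds for the denominator on the far sides\<close>

lemma sinh_ge_self: "x \<ge> 0 \<Longrightarrow> x \<le> sinh (x::real)"
proof -
  assume "x \<ge> 0"
  have "(\<lambda>x. sinh x - x) 0 \<le> (\<lambda>x. sinh x - x) x"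
  proof (rule DERIV_nonneg_imp_nondecreasing[OF \<open>x \<ge> 0\<close>])
    fix t :: real
    show "\<exists>y. ((\<lambda>x. sinh x - x) has_real_derivative y) (at t) \<and> y \<ge> 0"
      using cosh_real_ge_1[of t] by (intro exI[of _ "cosh t - 1"]) (auto intro!: derivative_eq_intros)
  qed
  thus ?thesis by simp
qed

lemma norm_cos_ge_sinh_Im: "Im w \<ge> 0 \<Longrightarrow> sinh (Im w) \<le> norm (cos w)"
  using norm_cosh_ge_sinh_Re[of "- \<i> * w"] by (simp add: cosh_conv_cos_complex)

lemma norm_cos_sq: "norm (cos w) ^ 2 = cos (Re w) ^ 2 + sinh (Im w) ^ 2"
  by (simp add: norm_cos_squared sinh_field_def exp_minus power_divide)

text \<open>On the two far sides \<open>max (Re z) (Im z) = N \<pi>\<close> of the square, so the factor \<open>cos ((1 - \<i>) z / 2)\<close>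
  satisfies \<open>|cos (p + \<i> t)|\<^sup>2 = cos\<^sup>2 t + sinh\<^sup>2 t \<ge> 1\<close>.\<close>
lemma norm_cos_plus_cosh_ge:
  fixes N :: nat
  defines "R \<equiv> real N * pi"
  assumes "Re z \<ge> 0" "Im z \<ge> 0" "max (Re z) (Im z) = R"
  shows "norm (cos z + cosh z) \<ge> 2 * sinh (R / 2)"
proof -
  define w where "w = (1 + \<i>) / 2 * z"
  define v where "v = (1 - \<i>) / 2 * z"
  \<comment> \<open>Here Im w = (Re z + Im z) / 2.\<close>
  have "R / 2 \<le> Im w" using assms by (auto simp: w_def)
  moreover have "R \<ge> 0" by (simp add: R_def)
  ultimately have w: "sinh (R / 2) \<le> norm (cos w)"
    using norm_cos_ge_sinh_Im[of w] sinh_real_le_iff[of "R / 2" "Im w"] by linarith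
  define t where "t = \<bar>Im v\<bar>"
  \<comment> \<open>Re v and Im v are half the sum and half the difference of the coordinates, the
    larger of which is \<open>R\<close>. As \<open>R\<close> is a multiple of pi, cos^2 does not see
    the shift.\<close>
  have "Re v = R - t" using assms(2-4) by (auto simp: v_def t_def max_def abs_if field_simps split: if_splits)
  moreover have "cos (R - t) ^ 2 = cos t ^ 2"
    by (simp add: R_def cos_diff power_mult_distrib cos_npi sin_npi flip: power_mult)
  moreover have "sinh (Im v) ^ 2 = sinh t ^ 2"
    by (simp add: t_def abs_if)
  ultimately have "norm (cos v) ^ 2 = cos t ^ 2 + sinh t ^ 2"
    by (simp add: norm_cos_sq)
  moreover have "sin t ^ 2 \<le> sinh t ^ 2"
  proof -
    have "\<bar>sin t\<bar> \<le> \<bar>t\<bar>" by (rule abs_sin_x_le_abs_x)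
    also have "\<dots> \<le> sinh t" using sinh_ge_self[of t] by (simp add: t_def)
    finally have "\<bar>sin t\<bar> ^ 2 \<le> sinh t ^ 2" by (intro power_mono) auto
    thus ?thesis by simp
  qed
  ultimately have "norm (cos v) ^ 2 \<ge> 1 ^ 2"
    using sin_cos_squared_add[of t] unfolding one_power2 by linarith
  hence v: "norm (cos v) \<ge> 1" by (rule power2_le_imp_le) auto
  have "2 * sinh (R / 2) * 1 \<le> 2 * norm (cos w) * norm (cos v)"
    using w v \<open>R \<ge> 0\<close> by (intro mult_mono) auto
  thus ?thesis
    by (simp add: cos_plus_cosh_complex norm_mult w_def v_def)
qed

section \<open>Convergence of the integral over the half-line\<close>

definition real_integrand :: "real \<Rightarrow> nat \<Rightarrow> real \<Rightarrow> real" where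
  "real_integrand a m x = x powr a / (cos x + cosh x) ^ m"

text \<open>Up to pi/2 the cosine is nonnegative. Beyond it, e^x >= 27/8 > 8/3, which is what e^x/2
  - 1 >= e^x/8 requires.\<close>

lemma cos_plus_cosh_ge_exp:
  assumes "x \<ge> 0"
  shows "exp x / 8 \<le> cos x + cosh (x :: real)"
proof (cases "x \<le> pi / 2")
  case True
  hence "cos x \<ge> 0" using assms by (intro cos_ge_zero) auto
  thus ?thesis by (simp add: cosh_field_def field_simps)
next
  case False
  have "(1 + 1 / 2) ^ 3 \<le> exp (1 / 2 :: real) ^ 3"
    by (intro power_mono exp_ge_add_one_self) auto
  also have "\<dots> = exp (3 / 2)" by (simp flip: exp_of_nat_mult)
  also have "\<dots> \<le> exp x" using False pi_gt3 by simp
  finally have "exp x \<ge> 27 / 8" by (simp add: power3_eq_cube)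
  moreover have "cos x \<ge> -1" by simp
  moreover have "cosh x \<ge> exp x / 2" by (simp add: cosh_field_def)
  ultimately show ?thesis by linarith
qed

lemma cos_plus_cosh_pos: "x \<ge> 0 \<Longrightarrow> cos x + cosh (x :: real) > 0"
  using cos_plus_cosh_ge_exp[of x] exp_gt_zero[of x] by linarith

text \<open>Dominated by 8^m x^a e^(-x), a multiple of the integrand of Gamma(a + 1).\<close>

lemma set_integrable_real_integrand:
  assumes "a > 0" "m > 0"
  shows "set_integrable lborel {0..} (real_integrand a m)"
proof (rule set_integrable_bound)
  have "integrable lborel (\<lambda>t. indicator {0..} t * t powr ((a + 1) - 1) / exp t)"
    using Gamma_conv_nn_integral_real[of "a + 1"] assms
    by (intro integrableI_nonneg) (auto simp: less_top[symmetric] simp flip: Gamma_conv_nn_integral_real)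
  hence "integrable lborel (\<lambda>t. 8 ^ m * (indicator {0..} t * t powr ((a + 1) - 1) / exp t))"
    by (rule integrable_mult_right)
  thus "set_integrable lborel {0..} (\<lambda>x. 8 ^ m * (x powr a / exp x))"
    by (simp add: set_integrable_def mult_ac)
  have "(cosh :: real \<Rightarrow> real) \<in> borel_measurable borel"
    by (intro borel_measurable_continuous_onI continuous_intros)
  thus "set_borel_measurable lborel {0..} (real_integrand a m)"
    unfolding set_borel_measurable_def real_integrand_def by measurable
  show "AE x in lborel. x \<in> {0..} \<longrightarrow>
          norm (real_integrand a m x) \<le> norm (8 ^ m * (x powr a / exp x))"
  proof (intro AE_I2 impI)
    fix x :: real assume "x \<in> {0..}"
    hence x: "x \<ge> 0" by simp
    have "exp x ^ 1 \<le> exp x ^ m" using x assms by (intro power_increasing) auto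
    also have "\<dots> = 8 ^ m * (exp x / 8) ^ m" by (simp add: power_divide)
    also have "\<dots> \<le> 8 ^ m * (cos x + cosh x) ^ m"
      using cos_plus_cosh_ge_exp[OF x] by (intro mult_left_mono power_mono) auto
    finally have "exp x / 8 ^ m \<le> (cos x + cosh x) ^ m" by (simp add: field_simps)
    hence "x powr a / (cos x + cosh x) ^ m \<le> x powr a / (exp x / 8 ^ m)"
      using cos_plus_cosh_pos[OF x] by (intro divide_left_mono) auto
    thus "norm (real_integrand a m x) \<le> norm (8 ^ m * (x powr a / exp x))"
      using cos_plus_cosh_pos[OF x] by (simp add: real_integrand_def mult_ac)
  qed
qed

lemma integral_real_integrand_tendsto:
  assumes "a > 0" "m > 0"
  shows "(\<lambda>N. integral {0..real N * pi} (real_integrand a m))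
           \<longlonglongrightarrow> (LBINT x:{0<..}. x powr a / (cos x + cosh x) ^ m)"
proof -
  have "((\<lambda>b. LBINT x:{0..b}. real_integrand a m x) \<longlongrightarrow> (LBINT x:{0..}. real_integrand a m x)) at_top"
    by (rule tendsto_set_lebesgue_integral_at_top)
       (use set_integrable_real_integrand[OF assms] in auto)
  moreover have "filterlim (\<lambda>N. real N * pi) at_top sequentially"
    by real_asymp
  ultimately have "(\<lambda>N. LBINT x:{0..real N * pi}. real_integrand a m x)
      \<longlonglongrightarrow> (LBINT x:{0..}. real_integrand a m x)"
    by (rule filterlim_compose)
  moreover have "(LBINT x:{0..real N * pi}. real_integrand a m x) =
      integral {0..real N * pi} (real_integrand a m)" for N
    by (intro set_borel_integral_eq_integral set_integrable_subset[OF set_integrable_real_integrand[OF assms]]) auto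
  \<comment> \<open>The integrand is 0 at the endpoint 0, so the two sides agree pointwise.\<close>
  moreover have "(LBINT x:{0..}. real_integrand a m x) = (LBINT x:{0<..}. x powr a / (cos x + cosh x) ^ m)"
    unfolding set_lebesgue_integral_def
    by (intro Bochner_Integration.integral_cong) (auto simp: real_integrand_def indicator_def)
  ultimately show ?thesis by simp
qed

section \<open>The four sides of the square\<close>

lemma cos_cosh_integrand_of_real:
  assumes "x \<ge> 0"
  shows "cos_cosh_integrand a m (of_real x) = of_real (real_integrand a m x)"
  using assms
  by (simp add: cos_cosh_integrand_def real_integrand_def cosh_of_real cos_of_real powr_of_real)

text \<open>At an imaginary point cos and cosh exchange roles, so only the power changes, by the
  factor i^a.\<close>

lemma cos_cosh_integrand_imaginary:
  assumes "y \<ge> 0"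
  shows "cos_cosh_integrand a m (Complex 0 y) = \<i> powr of_real a * of_real (real_integrand a m y)"
proof -
  have y: "Complex 0 y = of_real y * \<i>" by (simp add: complex_eq_iff)
  have "\<i> * (of_real y * \<i>) = - of_real y" by (simp add: complex_eq_iff)
  hence "cosh (of_real y * \<i>) = cos (of_real y)"
    by (simp add: cosh_conv_cos_complex)
  moreover have "cos (of_real y * \<i>) = cosh (of_real y)"
    by (simp add: cosh_conv_cos_complex mult.commute)
  moreover have "(of_real y * \<i>) powr of_real a = of_real (y powr a) * \<i> powr of_real a"
    using assms by (simp add: powr_times_real_left powr_of_real)
  ultimately show ?thesis
    by (simp add: y cos_cosh_integrand_def real_integrand_def cosh_of_real cos_of_real add.commute)
qed

text \<open>On either far side |z| <= 2R, and the denominator is at least (2 sinh (R/2))^m >= 2 sinh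
  (R/2), since 2 sinh (R/2) >= 1; the side has length \<open>R\<close>.\<close>

lemma far_sides_bound:
  assumes "a > 0" "m > 0" "N > 0"
  defines "R \<equiv> real N * pi"
  assumes "p \<in> {Complex R 0, Complex 0 R}" "q = Complex R R"
    and sub: "closed_segment p q \<subseteq> pole_free_quadrant"
  shows "norm (contour_integral (linepath p q) (cos_cosh_integrand a m))
           \<le> (2 * R) powr a / (2 * sinh (R / 2)) * R"
proof -
  have "R \<ge> 1 * pi" unfolding R_def using assms(3) by (intro mult_right_mono) auto
  hence R: "R > 3" using pi_gt3 by linarith
  hence sinh: "2 * sinh (R / 2) \<ge> 1" using sinh_ge_self[of "R / 2"] by linarith
  let ?B = "(2 * R) powr a / (2 * sinh (R / 2))"
  have "norm (contour_integral (linepath p q) (cos_cosh_integrand a m)) \<le> ?B * norm (q - p)"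
  proof (rule contour_integral_bound_linepath)
    show "cos_cosh_integrand a m contour_integrable_on linepath p q"
      by (intro contour_integrable_continuous_linepath
            continuous_on_subset[OF continuous_on_cos_cosh_integrand sub] assms)
    show "?B \<ge> 0" using sinh by (intro divide_nonneg_nonneg powr_ge_zero) linarith
    fix z assume "z \<in> closed_segment p q"
    hence z: "Re z \<ge> 0" "Im z \<ge> 0" "max (Re z) (Im z) = R" "Re z \<le> R" "Im z \<le> R"
      using assms(5,6) R
      by (auto simp: closed_segment_same_Re closed_segment_same_Im closed_segment_eq_real_ivl)
    have "norm z \<le> 2 * R" using cmod_le[of z] z by linarith
    hence num: "norm z powr a \<le> (2 * R) powr a" using assms(1) by (intro powr_mono2) auto
    have "2 * sinh (R / 2) = (2 * sinh (R / 2)) ^ 1" by simp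
    also have "\<dots> \<le> (2 * sinh (R / 2)) ^ m" using sinh assms(2) by (intro power_increasing) auto
    also have "\<dots> \<le> norm (cos z + cosh z) ^ m"
      using norm_cos_plus_cosh_ge[of z N] z sinh by (intro power_mono) (auto simp: R_def)
    finally have "2 * sinh (R / 2) \<le> norm (cos z + cosh z) ^ m" .
    thus "norm (cos_cosh_integrand a m z) \<le> ?B"
      using num sinh R
      by (auto simp: cos_cosh_integrand_def norm_divide norm_power norm_powr_real_powr'
               intro!: frac_le)
  qed
  also have "norm (q - p) = R"
    using assms(5,6) R by (auto simp: cmod_def)
  finally show ?thesis .
qed

lemma quadrant_integral_approx:
  assumes "a > 0" "m > 0" "N > 0"
  defines "R \<equiv> real N * pi"
  shows "norm (2 * pi * \<i> * (\<Sum>n<N. residue (cos_cosh_integrand a m) (cos_cosh_pole n))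
            - (1 - \<i> powr of_real (a + 1)) * of_real (integral {0..R} (real_integrand a m)))
           \<le> 2 * ((2 * R) powr a / (2 * sinh (R / 2)) * R)"
proof -
  let ?f = "cos_cosh_integrand a m"
  let ?I = "\<lambda>p q. contour_integral (linepath p q) ?f"
  let ?H = "integral {0..R} (real_integrand a m)"
  have R: "R > 0" using assms by simp
  have "real_integrand a m integrable_on {0..R}"
    by (intro set_borel_integral_eq_integral(1)
          set_integrable_subset[OF set_integrable_real_integrand[OF assms(1,2)]]) auto
  hence of_real_H: "integral {0..R} (\<lambda>x. complex_of_real (real_integrand a m x)) = of_real ?H"
    by (intro integral_unique has_integral_of_real integrable_integral)
  have zero: "Complex 0 0 = 0" by (simp add: complex_eq_iff)
  have img: "path_image (rectpath 0 (Complex R R)) \<subseteq> pole_free_quadrant"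
    using rectpath_pole_free[of 0 N] assms by (simp add: zero)
  hence segs: "closed_segment (Complex R 0) (Complex R R) \<subseteq> pole_free_quadrant"
    "closed_segment (Complex R R) (Complex 0 R) \<subseteq> pole_free_quadrant"
    "closed_segment (Complex 0 R) 0 \<subseteq> pole_free_quadrant"
    by (auto simp: rectpath_def Let_def path_image_join)
  note cont = continuous_on_subset[OF continuous_on_cos_cosh_integrand[OF assms(1), of m]]
  have "contour_integral (rectpath 0 (Complex R R)) ?f =
          ?I 0 (Complex R 0) + ?I (Complex R 0) (Complex R R) + ?I (Complex R R) (Complex 0 R) + ?I (Complex 0 R) 0"
    using contour_integral_rectpath_split[OF cont[OF img]] by simp
  moreover have "?I 0 (Complex R 0) = of_real ?H"
  proof -
    have "Complex R 0 = of_real R" by (simp add: complex_eq_iff)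
    hence "?I 0 (Complex R 0) = integral {0..R} (\<lambda>x. ?f (of_real x))"
      using contour_integral_linepath_Reals_eq[of 0 "of_real R" ?f] R by simp
    also have "\<dots> = integral {0..R} (\<lambda>x. of_real (real_integrand a m x))"
      by (intro integral_cong) (simp add: cos_cosh_integrand_of_real)
    also have "\<dots> = of_real ?H" by (rule of_real_H)
    finally show ?thesis .
  qed
  \<comment> \<open>The minus sign comes from the downward orientation; dz = i dy raises i^a to
    i^(a+1).\<close>
  moreover have "?I (Complex 0 R) 0 = - (\<i> powr of_real (a + 1)) * of_real ?H"
  proof -
    have "?I (Complex 0 R) 0 = - ?I 0 (Complex 0 R)"
      by (intro contour_integral_reverse_linepath cont segs)
    also have "?I 0 (Complex 0 R) = \<i> * integral {0..R} (\<lambda>y. ?f (Complex 0 y))"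
      using R by (intro contour_integral_linepath_same_Re) auto
    also have "integral {0..R} (\<lambda>y. ?f (Complex 0 y)) =
               integral {0..R} (\<lambda>y. \<i> powr of_real a * of_real (real_integrand a m y))"
      by (intro integral_cong) (simp add: cos_cosh_integrand_imaginary)
    also have "\<dots> = \<i> powr of_real a * of_real ?H" by (simp add: of_real_H)
    finally show ?thesis by (simp add: powr_add)
  qed
  moreover have "?I (Complex R R) (Complex 0 R) = - ?I (Complex 0 R) (Complex R R)"
    by (intro contour_integral_reverse_linepath cont segs)
  ultimately have eq: "2 * pi * \<i> * (\<Sum>n<N. residue ?f (cos_cosh_pole n)) -
      (1 - \<i> powr of_real (a + 1)) * of_real ?H = ?I (Complex R 0) (Complex R R) - ?I (Complex 0 R) (Complex R R)"
    using contour_integral_rectpath_0[OF assms(1,3), of m] by (simp add: R_def algebra_simps)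
  have "norm (?I (Complex R 0) (Complex R R) - ?I (Complex 0 R) (Complex R R)) \<le>
          norm (?I (Complex R 0) (Complex R R)) + norm (?I (Complex 0 R) (Complex R R))"
    by (rule norm_triangle_ineq4)
  also have "\<dots> \<le> 2 * ((2 * R) powr a / (2 * sinh (R / 2)) * R)"
  proof -
    have seg: "closed_segment (Complex 0 R) (Complex R R) \<subseteq> pole_free_quadrant"
      using segs(2) by (subst closed_segment_commute)
    have "norm (?I (Complex R 0) (Complex R R)) \<le> (2 * R) powr a / (2 * sinh (R / 2)) * R"
      using segs(1) unfolding R_def by (rule far_sides_bound[OF assms(1-3) insertI1 refl])
    moreover have "norm (?I (Complex 0 R) (Complex R R)) \<le> (2 * R) powr a / (2 * sinh (R / 2)) * R"
      using seg unfolding R_def by (rule far_sides_bound[OF assms(1-3) insertI2[OF singletonI] refl])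
    ultimately show ?thesis by linarith
  qed
  finally show ?thesis unfolding eq .
qed

text \<open>The far-side bound tends to 0, because sinh outgrows powers. Thus convergence of the
  residue series is inherited from the integrals over [0, N pi].\<close>

lemma residues_sums:
  assumes "a > 0" "m > 0"
  shows "(\<lambda>n. 2 * pi * \<i> * residue (cos_cosh_integrand a m) (cos_cosh_pole n)) sums
           ((1 - \<i> powr of_real (a + 1)) *
             of_real (LBINT x:{0<..}. x powr a / (cos x + cosh x) ^ m))"
proof -
  let ?I = "\<lambda>N. (1 - \<i> powr of_real (a + 1)) * of_real (integral {0..real N * pi} (real_integrand a m))"
  let ?S = "\<lambda>N. 2 * pi * \<i> * (\<Sum>n<N. residue (cos_cosh_integrand a m) (cos_cosh_pole n))"
  have "(\<lambda>N. ?S N - ?I N) \<longlonglongrightarrow> 0"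
  proof (rule Lim_null_comparison)
    show "eventually (\<lambda>N. norm (?S N - ?I N) \<le> 2 * ((2 * (real N * pi)) powr a /
             (2 * sinh ((real N * pi) / 2)) * (real N * pi))) sequentially"
      using eventually_gt_at_top[of 0] by eventually_elim (intro quadrant_integral_approx assms)
    show "(\<lambda>N. 2 * ((2 * (real N * pi)) powr a / (2 * sinh ((real N * pi) / 2)) * (real N * pi))) \<longlonglongrightarrow> 0"
      unfolding sinh_field_def by real_asymp
  qed
  moreover have "?I \<longlonglongrightarrow> (1 - \<i> powr of_real (a + 1)) *
             of_real (LBINT x:{0<..}. x powr a / (cos x + cosh x) ^ m)"
    by (intro tendsto_intros integral_real_integrand_tendsto assms)
  ultimately have "(\<lambda>N. (?S N - ?I N) + ?I N) \<longlonglongrightarrow> 0 + (1 - \<i> powr of_real (a + 1)) *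
             of_real (LBINT x:{0<..}. x powr a / (cos x + cosh x) ^ m)"
    by (rule tendsto_add)
  thus ?thesis by (simp add: sums_def sum_distrib_left)
qed

text \<open>The double sum in the theorem divided by \<open>- pi\<close>.\<close>

definition pole_sum :: "real \<Rightarrow> nat \<Rightarrow> real" where
  "pole_sum a m = (\<Sum>l=0..(m - 1) div 2. \<Sum>j=0..m - 1 - 2 * l.
            (-1) ^ l * 2 ^ l * gamma_coeff l m / fact (m - 1 - 2 * l - j)
            * (a gchoose j) * pi powr (a - real j)
            * Lim (at pi) ((deriv ^^ (m - 1 - 2 * l - j)) (cosh_series a l m)))"

text \<open>The sums over \<open>l\<close> and \<open>j\<close> are finite, so the series over the
  poles can be taken inside them, where \<open>cosh_series_deriv_sums\<close> evaluates it.\<close>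

lemma pole_coeff_sums:
  assumes "m > 0"
  shows "(\<lambda>n. (-1) ^ (m * Suc n) * pole_coeff a m n) sums of_real (pole_sum a m)"
proof -
  have "(\<lambda>n. \<Sum>l=0..(m - 1) div 2. \<Sum>j=0..m - 1 - 2 * l.
      of_real ((-1) ^ l * 2 ^ l * gamma_coeff l m / fact (m - 1 - 2 * l - j)
            * (a gchoose j) * pi powr (a - real j)) *
      ((-1) ^ (m * Suc n) * of_real (half_odd (Suc n) powr (a + 1 + 2 * real l - real m + real (m - 1 - 2 * l - j)))
                * (deriv ^^ (m - 1 - 2 * l - j)) (sech_power m) (of_real (half_odd (Suc n) * pi))))
    sums (\<Sum>l=0..(m - 1) div 2. \<Sum>j=0..m - 1 - 2 * l.
      of_real ((-1) ^ l * 2 ^ l * gamma_coeff l m / fact (m - 1 - 2 * l - j)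
            * (a gchoose j) * pi powr (a - real j)) *
      of_real (Lim (at pi) ((deriv ^^ (m - 1 - 2 * l - j)) (cosh_series a l m))))"
    by (intro sums_sum sums_mult cosh_series_deriv_sums assms)
  also have "(\<Sum>l=0..(m - 1) div 2. \<Sum>j=0..m - 1 - 2 * l.
      of_real ((-1) ^ l * 2 ^ l * gamma_coeff l m / fact (m - 1 - 2 * l - j)
            * (a gchoose j) * pi powr (a - real j)) *
      complex_of_real (Lim (at pi) ((deriv ^^ (m - 1 - 2 * l - j)) (cosh_series a l m))))
     = of_real (pole_sum a m)"
    by (simp add: pole_sum_def)
  also have "(\<lambda>n. \<Sum>l=0..(m - 1) div 2. \<Sum>j=0..m - 1 - 2 * l.
      of_real ((-1) ^ l * 2 ^ l * gamma_coeff l m / fact (m - 1 - 2 * l - j)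
            * (a gchoose j) * pi powr (a - real j)) *
      ((-1) ^ (m * Suc n) * of_real (half_odd (Suc n) powr (a + 1 + 2 * real l - real m + real (m - 1 - 2 * l - j)))
                * (deriv ^^ (m - 1 - 2 * l - j)) (sech_power m) (of_real (half_odd (Suc n) * pi))))
     = (\<lambda>n. (-1) ^ (m * Suc n) * pole_coeff a m n)"
    unfolding pole_coeff_def sum_distrib_left
  proof (intro ext sum.cong refl)
    fix n l j assume l: "l \<in> {0..(m - 1) div 2}" and j: "j \<in> {0..m - 1 - 2 * l}"
    define D where "D = (deriv ^^ (m - 1 - 2 * l - j)) (sech_power m) (of_real (half_odd (Suc n) * pi))"
    have "2 * l \<le> m - 1" using l by auto
    \<comment> \<open>Hence the natural-number subtraction is not truncated, and
      \<open>m - 1 - 2 * l - j\<close> derivatives bring the exponent to exactly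
      \<open>a - j\<close>.\<close>
    hence "2 * l + j + 1 \<le> m" using j assms by auto
    hence e: "a + 1 + 2 * real l - real m + real (m - 1 - 2 * l - j) = a - real j"
      by (simp add: of_nat_diff)
    have p: "(half_odd (Suc n) * pi) powr (a - real j) =
             half_odd (Suc n) powr (a - real j) * pi powr (a - real j)"
      by (rule powr_mult)
    show "of_real ((-1) ^ l * 2 ^ l * gamma_coeff l m / fact (m - 1 - 2 * l - j)
            * (a gchoose j) * pi powr (a - real j)) *
      ((-1) ^ (m * Suc n) * of_real (half_odd (Suc n) powr (a + 1 + 2 * real l - real m + real (m - 1 - 2 * l - j)))
                * (deriv ^^ (m - 1 - 2 * l - j)) (sech_power m) (of_real (half_odd (Suc n) * pi))) =
       (-1) ^ (m * Suc n) * (of_real ((-1) ^ l * 2 ^ l * gamma_coeff l m * (a gchoose j)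
        * (half_odd (Suc n) * pi) powr (a - real j) / fact (m - 1 - 2 * l - j))
     * (deriv ^^ (m - 1 - 2 * l - j)) (sech_power m) (of_real (half_odd (Suc n) * pi)))"
      unfolding e p D_def[symmetric] by (simp add: field_simps)
  qed
  finally show ?thesis .
qed

theorem theorem3p3:
  fixes m :: nat and a :: real
  assumes "m > 0" and "a > 0"
  shows
    "2 powi (int m - 2) * (1 - \<i> powr complex_of_real (a + 1))
        / (1 + \<i>) powr complex_of_real (a - 1)
        * complex_of_real (LBINT x:{0<..}. x powr a / (cos x + cosh x) ^ m)
     = complex_of_real
         (\<Sum>l=0..(m - 1) div 2. \<Sum>j=0..m - 1 - 2 * l.
            (-1) ^ (l + 1) * 2 ^ l * gamma_coeff l m / fact (m - 1 - 2 * l - j)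
            * (a gchoose j) * pi powr (a + 1 - real j)
            * Lim (at pi) ((deriv ^^ (m - 1 - 2 * l - j)) (cosh_series a l m)))"
proof -
  define J where "J = (LBINT x:{0<..}. x powr a / (cos x + cosh x) ^ m)"
  define K where "K = 2 * pi * \<i> * ((1 + \<i>) powr of_real a * (1 + \<i>) / 2 ^ m)"
  have nz: "1 + \<i> \<noteq> 0" by (simp add: complex_eq_iff)
  have "(\<lambda>n. K * ((-1) ^ (m * Suc n) * pole_coeff a m n)) sums (K * of_real (pole_sum a m))"
    by (intro sums_mult pole_coeff_sums assms)
  moreover have "(\<lambda>n. K * ((-1) ^ (m * Suc n) * pole_coeff a m n)) sums
      ((1 - \<i> powr of_real (a + 1)) * of_real J)"
    using residues_sums[OF assms(2,1)]
    by (simp add: residue_cos_cosh_integrand[OF assms(1)] K_def J_def mult_ac)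
  \<comment> \<open>Both are sums of the same series of residues times 2 pi i.\<close>
  ultimately have eq: "(1 - \<i> powr of_real (a + 1)) * of_real J = K * of_real (pole_sum a m)"
    by (rule sums_unique2[symmetric])
  \<comment> \<open>This explains the normalisation on the left of the theorem: 2^(m-2) / 2^m = 1/4
    and i (1 + i)^2 = -2, so 2 pi i (1 + i)^(a+1) / 4 = -pi (1 + i)^(a-1).\<close>
  have "2 powi (int m - 2) * K = - pi * ((1 + \<i>) powr of_real (a - 1))"
  proof -
    have "2 powi (int m - 2) = (2 ^ m / 4 :: complex)"
      by (simp add: power_int_diff)
    moreover have "(1 + \<i>) powr of_real a = (1 + \<i>) powr of_real (a - 1) * (1 + \<i>)"
      using nz by (simp add: powr_diff)
    moreover have "\<i> * (1 + \<i>) * (1 + \<i>) = - 2"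
      by (simp add: complex_eq_iff)
    ultimately show ?thesis
      by (simp add: K_def field_simps)
  qed
  moreover have "(1 + \<i>) powr of_real (a - 1) \<noteq> 0" using nz by simp
  moreover have "2 powi (int m - 2) * (1 - \<i> powr complex_of_real (a + 1))
        / (1 + \<i>) powr complex_of_real (a - 1) * of_real J =
      2 powi (int m - 2) * K * of_real (pole_sum a m) / (1 + \<i>) powr complex_of_real (a - 1)"
    unfolding times_divide_eq_left mult.assoc eq ..
  ultimately have "2 powi (int m - 2) * (1 - \<i> powr complex_of_real (a + 1))
        / (1 + \<i>) powr complex_of_real (a - 1) * of_real J = of_real (- pi * pole_sum a m)"
    by simp
  also have "- pi * pole_sum a m = (\<Sum>l=0..(m - 1) div 2. \<Sum>j=0..m - 1 - 2 * l.
            (-1) ^ (l + 1) * 2 ^ l * gamma_coeff l m / fact (m - 1 - 2 * l - j)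
            * (a gchoose j) * pi powr (a + 1 - real j)
            * Lim (at pi) ((deriv ^^ (m - 1 - 2 * l - j)) (cosh_series a l m)))"
  proof -
    have "pi powr (a + 1 - real j) = pi * pi powr (a - real j)" for j
      using powr_add[of pi 1 "a - real j"] by (simp add: algebra_simps)
    thus ?thesis
      unfolding pole_sum_def sum_distrib_left by (intro sum.cong refl) simp
  qed
  finally show ?thesis by (simp only: J_def)
qed

end
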